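(* Let $k$ be a field of characteristic different from $2$, let $C\in\operatorname{Mat}_2(k)$ be cyclic, and put $\tau=\operatorname{tr}(C)$, $\nu=\det(C)$. Let $F\in\operatorname{GL}_2(k)$, let $K_i\in\operatorname{Orb}(C)$, and put $G_i=FK_i$. (1) If $\tau\ne0$ and $K_1,\dots,K_4$ is affinely saturated, then $G_1,\dots,G_4$ determine $F$ uniquely (i.e. $F$ is the only $F'\in\operatorname{GL}_2(k)$ with $F'^{-1}G_i\in\operatorname{Orb}(C)$ for $i=1,\dots,4$). In fact the trace equations $\operatorname{tr}(UG_i)=\tau$ $(i=1,\dots,4)$ alone, for $U\in\operatorname{Mat}_2(k)$, have the unique solution $U=F^{-1}$. (2) If $\tau=0$, $\nu\ne0$ and $K_1,K_2,K_3$ is linearly saturated, then the solution set in $\operatorname{Mat}_2(k)$ of the homogeneous trace equations $\operatorname{tr}(UG_i)=0$ $(i=1,2,3)$ is the line $kF^{-1}$, and imposing in addition $\det(UG_1)=\nu$ leaves exactly $U=\pm F^{-1}$. (3) If $\tau=\nu=0$ and $K_1,K_2,K_3$ is linearly saturated, then the solution set in $\operatorname{Mat}_2(k)$ of $\operatorname{tr}(UG_i)=0$ $(i=1,2,3)$ is exactly the line $kF^{-1}$; therefore $G_1,G_2,G_3$ determine the projective class of $F$ (the class of $F$ modulo $k^\times$).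
   Context: A matrix $C\in\operatorname{Mat}_2(k)$ is cyclic if there exists $v\in k^2$ such that $(v,Cv)$ is a basis of $k^2$. $\operatorname{Orb}(C)=\{PCP^{-1}:P\in\operatorname{GL}_2(k)\}$ and $\mathfrak{sl}_2(k)=\{X\in\operatorname{Mat}_2(k):\operatorname{tr}(X)=0\}$. A family $K_1,\dots,K_m\in\operatorname{Orb}(C)$ is affinely saturated if $\operatorname{span}_k\{K_i-K_1:i=2,\ldots,m\}=\mathfrak{sl}_2(k)$; if $\operatorname{tr}(C)=0$ it is linearly saturated if $\operatorname{span}_k\{K_1,\ldots,K_m\}=\mathfrak{sl}_2(k)$. *)

theory Defs
  imports "HOL-Analysis.Analysis"
begin

(* The library's ( *s ) on 'a^'n^'m takes scalars from 'a^'n (matrices seen as vectors of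
   rows over a componentwise ring), so the 'a-vector space structure is set up here. *)
definition mat_scale :: "'a::times \<Rightarrow> 'a^'n^'m \<Rightarrow> 'a^'n^'m" (infixr "*\<^sub>m" 75)
  where "c *\<^sub>m A = (\<chi> i j. c * A $ i $ j)"

interpretation matrices: vector_space "mat_scale :: 'a::field \<Rightarrow> 'a^'n^'m \<Rightarrow> 'a^'n^'m"
  by unfold_locales (simp_all add: mat_scale_def vec_eq_iff algebra_simps)

definition cyclic :: "'k::field^2^2 \<Rightarrow> bool"
  where "cyclic C \<longleftrightarrow> (\<exists>v. v \<noteq> C *v v \<and> vec.independent {v, C *v v} \<and>
                          vec.span {v, C *v v} = UNIV)"

definition Orb :: "'k::field^2^2 \<Rightarrow> ('k^2^2) set"
  where "Orb C = {P ** C ** matrix_inv P | P. invertible P}"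

definition sl2 :: "('k::field^2^2) set"
  where "sl2 = {X. trace X = 0}"

(* A family K_1, ..., K_m is a function on nat of which only the indices 1, ..., m matter;
   that its members lie in Orb C is a separate hypothesis wherever saturation is used. *)
definition affinely_saturated :: "nat \<Rightarrow> (nat \<Rightarrow> 'k::field^2^2) \<Rightarrow> bool"
  where "affinely_saturated m K \<longleftrightarrow> matrices.span {K i - K 1 | i. i \<in> {2..m}} = sl2"

definition linearly_saturated :: "nat \<Rightarrow> (nat \<Rightarrow> 'k::field^2^2) \<Rightarrow> bool"
  where "linearly_saturated m K \<longleftrightarrow> matrices.span {K i | i. i \<in> {1..m}} = sl2"

definition proj_class :: "'k::field^2^2 \<Rightarrow> ('k^2^2) set"
  where "proj_class F = {c *\<^sub>m F | c. c \<noteq> 0}"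

end

theory Submission
  imports Defs
begin

text \<open>
  Put \<open>W = U F\<close>.  Since \<open>U G\<^sub>i = W K\<^sub>i\<close>, the trace equations prescribe values of the linear functional
  \<open>X \<mapsto> tr (W X)\<close> at the points \<open>K\<^sub>i\<close>, and \<open>W\<close> determines \<open>U = W F\<^sup>-\<^sup>1\<close>.  Saturation,
  after subtracting the first equation from the others in the affine case, turns these equations
  into the vanishing of this functional on all of \<open>sl\<^sub>2\<close>.  The trace form is nondegenerate and
  the scalar matrices are the orthogonal complement of \<open>sl\<^sub>2\<close>, so \<open>W\<close> is a scalar
  matrix \<open>c\<close>, that is, \<open>U = c F\<^sup>-\<^sup>1\<close> (lemmas \<open>trace_annihilates_sl2_imp_scalar\<close> and
  \<open>trace_annihilates_span_sl2_imp_multiple_inverse\<close>).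

  It remains to determine \<open>c\<close>.  In the affine case any one of the inhomogeneous equations reads
  \<open>c \<tau> = \<tau>\<close> with \<open>\<tau> \<noteq> 0\<close>, so \<open>c = 1\<close>.  In the traceless case every \<open>c\<close> solves the homogeneous
  equations; the determinant equation reads \<open>c\<^sup>2 \<nu> = \<nu>\<close>, which for \<open>\<nu> \<noteq> 0\<close> leaves \<open>c = \<plusminus>1\<close>.
  A competing \<open>F'\<close> with \<open>F'\<^sup>-\<^sup>1 G\<^sub>i\<close> in the orbit yields the solution \<open>U = F'\<^sup>-\<^sup>1\<close> of the trace
  equations, because the trace is constant on the orbit; hence \<open>F = c F'\<close>, where \<open>c = 1\<close>
  in the affine case and \<open>c \<noteq> 0\<close> in the traceless one because \<open>F\<close> is invertible.
\<close>

lemma mat_scale_matrix_mul: "(c *\<^sub>m A) ** B = c *\<^sub>m (A ** B)"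
  for A :: "'k::field^'n^'m" and B :: "'k^'p^'n"
  by (simp add: mat_scale_def matrix_matrix_mult_def vec_eq_iff sum_distrib_left mult.assoc)

lemma matrix_mul_mat_scale: "A ** (c *\<^sub>m B) = c *\<^sub>m (A ** B)"
  for A :: "'k::field^'n^'m" and B :: "'k^'p^'n"
  by (simp add: mat_scale_def matrix_matrix_mult_def vec_eq_iff sum_distrib_left ac_simps)

lemma trace_mat_scale: "trace (c *\<^sub>m A) = c * trace A"
  for A :: "'k::field^'n^'n"
  by (simp add: mat_scale_def trace_def sum_distrib_left)

lemma det_mat_scale_2: "det (c *\<^sub>m A) = c\<^sup>2 * det A"
  for A :: "'k::field^2^2"
  by (simp add: mat_scale_def det_2 power2_eq_square algebra_simps)

lemma matrix_inv_left_right: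
  fixes A :: "'k::field^'n^'n"
  assumes "invertible A"
  shows "matrix_inv A ** A = mat 1" and "A ** matrix_inv A = mat 1"
  using someI_ex[OF assms[unfolded invertible_def]] by (simp_all add: matrix_inv_def)

lemma matrix_inv_mul_cancel: "invertible A \<Longrightarrow> matrix_inv A ** (A ** B) = B"
  for A :: "'k::field^'n^'n" and B :: "'k^'p^'n"
  by (simp add: matrix_mul_assoc matrix_inv_left_right)

lemma trace_Orb: "X \<in> Orb C \<Longrightarrow> trace X = trace C"
  unfolding Orb_def
proof clarify
  fix P :: "'a^2^2"
  assume P: "invertible P"
  have "trace (P ** C ** matrix_inv P) = trace (matrix_inv P ** (P ** C))"
    by (rule trace_mul_sym)
  then show "trace (P ** C ** matrix_inv P) = trace C"
    by (simp add: matrix_inv_mul_cancel P)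
qed

lemma det_Orb: "X \<in> Orb C \<Longrightarrow> det X = det C"
  unfolding Orb_def
proof clarify
  fix P :: "'a^2^2"
  assume P: "invertible P"
  have "det (P ** C ** matrix_inv P) = det (P ** matrix_inv P) * det C"
    by (simp add: det_mul)
  then show "det (P ** C ** matrix_inv P) = det C"
    by (simp add: matrix_inv_left_right P)
qed

lemma trace_matrix_mul_span_eq_0:
  fixes W :: "'k::field^2^2"
  assumes "\<And>X. X \<in> S \<Longrightarrow> trace (W ** X) = 0" and "X \<in> matrices.span S"
  shows "trace (W ** X) = 0"
  using assms(2)
proof (induction rule: matrices.span_induct_alt)
  case base
  show ?case by (simp add: matrix_matrix_mult_def trace_def)
next
  case (step c Y Z)
  then show ?case
    by (simp add: matrix_add_ldistrib trace_add matrix_mul_mat_scale trace_mat_scale assms(1))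
qed

text \<open>
  The three test matrices form the standard basis of \<open>sl\<^sub>2\<close>: the two nilpotent ones annihilate the
  off-diagonal entries of \<open>W\<close>, the diagonal one equates its diagonal entries.
\<close>

lemma trace_annihilates_sl2_imp_scalar:
  fixes W :: "'k::field^2^2"
  assumes "\<And>X. X \<in> sl2 \<Longrightarrow> trace (W ** X) = 0"
  shows "\<exists>c. W = mat c"
proof -
  note entries = sl2_def trace_def matrix_matrix_mult_def sum_2
  define E :: "'k^2^2" where "E = vector [vector [0, 1], vector [0, 0]]"
  define E' :: "'k^2^2" where "E' = vector [vector [0, 0], vector [1, 0]]"
  define H :: "'k^2^2" where "H = vector [vector [1, 0], vector [0, -1]]"
  have "W $ 2 $ 1 = 0"
    using assms[of E] by (simp add: E_def entries)
  moreover have "W $ 1 $ 2 = 0"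
    using assms[of E'] by (simp add: E'_def entries)
  moreover have "W $ 2 $ 2 = W $ 1 $ 1"
    using assms[of H] by (simp add: H_def entries)
  ultimately have "W = mat (W $ 1 $ 1)"
    by (simp add: mat_def vec_eq_iff forall_2)
  then show ?thesis ..
qed

text \<open>
  Both kinds of saturation enter through this lemma, with \<open>S\<close> the differences \<open>K\<^sub>i - K\<^sub>1\<close> in the
  affine case and the matrices \<open>K\<^sub>i\<close> themselves in the linear case.
\<close>

lemma trace_annihilates_span_sl2_imp_multiple_inverse:
  fixes U F :: "'k::field^2^2"
  assumes F: "invertible F"
    and span: "matrices.span S = sl2"
    and zero: "\<And>X. X \<in> S \<Longrightarrow> trace (U ** (F ** X)) = 0"
  shows "\<exists>c. U = c *\<^sub>m matrix_inv F"
proof -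
  have "trace ((U ** F) ** X) = 0" if "X \<in> sl2" for X
    using trace_matrix_mul_span_eq_0[of S "U ** F" X] zero that
    by (simp add: span matrix_mul_assoc)
  then obtain c where "U ** F = mat c"
    using trace_annihilates_sl2_imp_scalar by blast
  moreover have "mat c = c *\<^sub>m mat 1"
    by (simp add: mat_def mat_scale_def vec_eq_iff)
  ultimately have "U ** F ** matrix_inv F = c *\<^sub>m matrix_inv F"
    by (metis mat_scale_matrix_mul matrix_mul_lid)
  then have "U = c *\<^sub>m matrix_inv F"
    by (simp add: matrix_inv_left_right F flip: matrix_mul_assoc)
  then show ?thesis ..
qed

lemma matrix_inv_eq_mat_scale_imp:
  fixes F F' :: "'k::field^'n^'n"
  assumes "invertible F" "invertible F'" and eq: "matrix_inv F' = c *\<^sub>m matrix_inv F"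
  shows "F = c *\<^sub>m F'"
proof -
  have "F = F' ** (matrix_inv F' ** F)"
    using assms(2) by (simp add: matrix_mul_assoc matrix_inv_left_right)
  also have "matrix_inv F' ** F = c *\<^sub>m mat 1"
    using assms(1) by (simp add: eq mat_scale_matrix_mul matrix_inv_left_right)
  finally show ?thesis by (simp add: matrix_mul_mat_scale)
qed

lemma proj_class_mat_scale:
  fixes F :: "'k::field^2^2"
  assumes "c \<noteq> 0"
  shows "proj_class (c *\<^sub>m F) = proj_class F"
proof -
  have "\<exists>e. d *\<^sub>m F = e *\<^sub>m c *\<^sub>m F \<and> e \<noteq> 0" if "d \<noteq> 0" for d
    using that assms by (intro exI[of _ "d / c"]) simp
  moreover have "\<exists>e. d *\<^sub>m c *\<^sub>m F = e *\<^sub>m F \<and> e \<noteq> 0" if "d \<noteq> 0" for d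
    using that assms by (intro exI[of _ "d * c"]) simp
  ultimately show ?thesis by (auto simp: proj_class_def)
qed

lemma affine_trace_solution_unique:
  fixes F U :: "'k::field^2^2" and K :: "nat \<Rightarrow> 'k^2^2"
  assumes F: "invertible F" and sat: "affinely_saturated m K"
    and m: "m \<ge> 1" and "\<tau> \<noteq> 0" and K1: "trace (K 1) = \<tau>"
    and U: "\<And>i. i \<in> {1..m} \<Longrightarrow> trace (U ** (F ** K i)) = \<tau>"
  shows "U = matrix_inv F"
proof -
  have "trace (U ** (F ** X)) = 0" if X: "X \<in> {K i - K 1 | i. i \<in> {2..m}}" for X
  proof -
    obtain i where i: "i \<in> {2..m}" and X: "X = K i - K 1" using X by blast
    have "U ** (F ** K i) = U ** (F ** X) + U ** (F ** K 1)"
      by (simp add: X flip: matrix_add_ldistrib)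
    then show ?thesis using U[of i] U[of 1] i m by (simp add: trace_add)
  qed
  then obtain c where c: "U = c *\<^sub>m matrix_inv F"
    using trace_annihilates_span_sl2_imp_multiple_inverse[OF F sat[unfolded affinely_saturated_def]]
    by blast
  then have "c * \<tau> = \<tau>"
    using U[of 1] m K1 by (simp add: mat_scale_matrix_mul trace_mat_scale matrix_inv_mul_cancel F)
  then show ?thesis using \<open>\<tau> \<noteq> 0\<close> c by simp
qed

lemma linear_trace_solutions:
  fixes F :: "'k::field^2^2" and K :: "nat \<Rightarrow> 'k^2^2"
  assumes F: "invertible F" and sat: "linearly_saturated m K"
    and K: "\<And>i. i \<in> {1..m} \<Longrightarrow> trace (K i) = 0"
  shows "{U. \<forall>i\<in>{1..m}. trace (U ** (F ** K i)) = 0} = {c *\<^sub>m matrix_inv F | c. True}"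
proof (intro subset_antisym subsetI)
  fix U assume "U \<in> {U. \<forall>i\<in>{1..m}. trace (U ** (F ** K i)) = 0}"
  then have "\<exists>c. U = c *\<^sub>m matrix_inv F"
    using sat unfolding linearly_saturated_def
    by (intro trace_annihilates_span_sl2_imp_multiple_inverse[OF F]) auto
  then show "U \<in> {c *\<^sub>m matrix_inv F | c. True}" by blast
qed (auto simp: mat_scale_matrix_mul trace_mat_scale matrix_inv_mul_cancel F K)

theorem corollary6p2:
  fixes C F :: "'k::field^2^2" and K G :: "nat \<Rightarrow> 'k^2^2" and \<tau> \<nu> :: 'k
  assumes char: "CHAR('k) \<noteq> 2"
    and C: "cyclic C"
    and tau: "\<tau> = trace C" and nu: "\<nu> = det C"
    and F: "invertible F"
    and G: "\<And>i. G i = F ** K i"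
  shows
    "(\<tau> \<noteq> 0 \<and> (\<forall>i\<in>{1..4}. K i \<in> Orb C) \<and> affinely_saturated 4 K \<longrightarrow>
        {F'. invertible F' \<and> (\<forall>i\<in>{1..4}. matrix_inv F' ** G i \<in> Orb C)} = {F} \<and>
        {U. \<forall>i\<in>{1..4}. trace (U ** G i) = \<tau>} = {matrix_inv F})
   \<and> (\<tau> = 0 \<and> \<nu> \<noteq> 0 \<and> (\<forall>i\<in>{1..3}. K i \<in> Orb C) \<and> linearly_saturated 3 K \<longrightarrow>
        {U. \<forall>i\<in>{1..3}. trace (U ** G i) = 0} = {c *\<^sub>m matrix_inv F | c. True} \<and>
        {U. (\<forall>i\<in>{1..3}. trace (U ** G i) = 0) \<and> det (U ** G 1) = \<nu>}
          = {matrix_inv F, - matrix_inv F})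
   \<and> (\<tau> = 0 \<and> \<nu> = 0 \<and> (\<forall>i\<in>{1..3}. K i \<in> Orb C) \<and> linearly_saturated 3 K \<longrightarrow>
        {U. \<forall>i\<in>{1..3}. trace (U ** G i) = 0} = {c *\<^sub>m matrix_inv F | c. True} \<and>
        (\<forall>F'. invertible F' \<and> (\<forall>i\<in>{1..3}. matrix_inv F' ** G i \<in> Orb C) \<longrightarrow>
              proj_class F' = proj_class F))"
proof (intro conjI impI; elim conjE)
  assume \<tau>: "\<tau> \<noteq> 0" and K: "\<forall>i\<in>{1..4}. K i \<in> Orb C" and sat: "affinely_saturated 4 K"
  have unique: "U = matrix_inv F" if "\<forall>i\<in>{1..4}. trace (U ** G i) = \<tau>" for U
    using that K \<tau> by (intro affine_trace_solution_unique[OF F sat, of \<tau>]) (auto simp: G tau trace_Orb)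
  show "{U. \<forall>i\<in>{1..4}. trace (U ** G i) = \<tau>} = {matrix_inv F}"
    using unique K by (auto simp: G matrix_inv_mul_cancel F tau trace_Orb)
  have "F' = F" if F': "invertible F'" and orb: "\<forall>i\<in>{1..4}. matrix_inv F' ** G i \<in> Orb C" for F'
  proof -
    have "matrix_inv F' = matrix_inv F" using orb by (intro unique) (simp add: trace_Orb tau)
    then show ?thesis using matrix_inv_eq_mat_scale_imp[OF F F', of 1] by simp
  qed
  then show "{F'. invertible F' \<and> (\<forall>i\<in>{1..4}. matrix_inv F' ** G i \<in> Orb C)} = {F}"
    using K F by (auto simp: G matrix_inv_mul_cancel)
next
  assume "\<tau> = 0" and \<nu>: "\<nu> \<noteq> 0" and K: "\<forall>i\<in>{1..3}. K i \<in> Orb C" and sat: "linearly_saturated 3 K"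
  then show line: "{U. \<forall>i\<in>{1..3}. trace (U ** G i) = 0} = {c *\<^sub>m matrix_inv F | c. True}"
    unfolding G by (intro linear_trace_solutions[OF F]) (auto simp: trace_Orb[of _ C] tau)
  have "det (K 1) = \<nu>"
    using K by (simp add: det_Orb[of _ C] nu)
  then have det: "det ((c *\<^sub>m matrix_inv F) ** G 1) = \<nu> \<longleftrightarrow> c = 1 \<or> c = -1" for c
    using \<nu> by (simp add: G mat_scale_matrix_mul matrix_inv_mul_cancel F det_mat_scale_2
        power2_eq_1_iff)
  have "{U. (\<forall>i\<in>{1..3}. trace (U ** G i) = 0) \<and> det (U ** G 1) = \<nu>}
      = {U \<in> {c *\<^sub>m matrix_inv F | c. True}. det (U ** G 1) = \<nu>}"
    unfolding line[symmetric] by simp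
  also have "\<dots> = {c *\<^sub>m matrix_inv F | c. c = 1 \<or> c = -1}"
    using det by blast
  also have "\<dots> = {1 *\<^sub>m matrix_inv F, (-1) *\<^sub>m matrix_inv F}" by blast
  finally show "{U. (\<forall>i\<in>{1..3}. trace (U ** G i) = 0) \<and> det (U ** G 1) = \<nu>}
      = {matrix_inv F, - matrix_inv F}" by simp
next
  assume "\<tau> = 0" and K: "\<forall>i\<in>{1..3}. K i \<in> Orb C" and sat: "linearly_saturated 3 K"
  then show line: "{U. \<forall>i\<in>{1..3}. trace (U ** G i) = 0} = {c *\<^sub>m matrix_inv F | c. True}"
    unfolding G by (intro linear_trace_solutions[OF F]) (auto simp: trace_Orb[of _ C] tau)
  show "\<forall>F'. invertible F' \<and> (\<forall>i\<in>{1..3}. matrix_inv F' ** G i \<in> Orb C) \<longrightarrow>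
      proj_class F' = proj_class F"
  proof (intro allI impI; elim conjE)
    fix F' assume F': "invertible F'" and orb: "\<forall>i\<in>{1..3}. matrix_inv F' ** G i \<in> Orb C"
    then have "matrix_inv F' \<in> {U. \<forall>i\<in>{1..3}. trace (U ** G i) = 0}"
      using \<open>\<tau> = 0\<close> by (simp add: trace_Orb[of _ C] tau)
    then obtain c where "matrix_inv F' = c *\<^sub>m matrix_inv F" unfolding line by blast
    then have c: "F = c *\<^sub>m F'" by (rule matrix_inv_eq_mat_scale_imp[OF F F'])
    moreover have "c \<noteq> 0"
      using F det_mat_scale_2[of c F'] by (auto simp: c invertible_det_nz)
    ultimately show "proj_class F' = proj_class F" by (simp add: proj_class_mat_scale)
  qed
qed

end
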